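(* Let $\mathcal{G}=(\mathcal{N},\mathcal{X}=\prod_{i=1}^N\mathbb{R}^{n_i},\{u_i\}_{i=1}^N)$ be a $\lambda$-cocoercive continuous game ($\lambda>0$) whose set of Nash equilibria $\mathcal{X}^*$ is nonempty. Let $(\mathbf{x}_t)_{t\ge0}$ be the iterates of the adaptive online gradient descent algorithm (defined in the context; it does not use $\lambda$), with arbitrary $\mathbf{x}_0\in\mathcal{X}$, $\beta_1>0$ and $r>1$. Then $\epsilon(\mathbf{x}_T)=o(1/T)$ as $T\to\infty$.
   Context: A continuous game $\mathcal{G}=(\mathcal{N},\mathcal{X}=\prod_{i=1}^N\mathcal{X}_i,\{u_i\}_{i=1}^N)$ consists of a finite set of players $\mathcal{N}=\{1,\dots,N\}$, action sets $\mathcal{X}_i$ (here $\mathcal{X}_i=\mathbb{R}^{n_i}$), and payoff functions $u_i:\mathcal{X}\to\mathbb{R}$ such that each $u_i$ is continuous in $\mathbf{x}$, continuously differentiable in $x_i$, and the partial gradient $\nabla_{x_i}u_i(\mathbf{x})$ is Lipschitz continuous in $\mathbf{x}$. Write $v_i(\mathbf{x})=\nabla_{x_i}u_i(\mathbf{x})$ and $\mathbf{v}(\mathbf{x})=(v_1(\mathbf{x}),\dots,v_N(\mathbf{x}))$. A point $\mathbf{x}^*\in\mathcal{X}$ is a Nash equilibrium if for every $i$, $u_i(x_i^*,\mathbf{x}_{-i}^* )\ge u_i(x_i,\mathbf{x}_{-i}^* )$ for all $x_i\in\mathcal{X}_i$, where $\mathbf{x}_{-i}$ denotes the joint action of all players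 except $i$. The game is $\lambda$-cocoercive if $(\mathbf{x}'-\mathbf{x})^\top(\mathbf{v}(\mathbf{x}')-\mathbf{v}(\mathbf{x}))\le-\lambda\|\mathbf{v}(\mathbf{x}')-\mathbf{v}(\mathbf{x})\|^2$ for all $\mathbf{x},\mathbf{x}'\in\mathcal{X}$. The norm $\|\cdot\|$ is Euclidean, and $\epsilon(\mathbf{x})=\|\mathbf{v}(\mathbf{x})\|^2$. Adaptive online gradient descent: initialize $\mathbf{x}_0\in\mathcal{X}$, $\beta_1>0$, $\eta_1=1/\beta_1$, and a tuning parameter $r>1$. For $t=0,1,2,\dots$: (1) set $x_{i,t+1}=x_{i,t}+\eta_{t+1}v_i(\mathbf{x}_t)$ for $i=1,\dots,N$; (2) set $\beta_{t+2}=r\beta_{t+1}$ if $\|\mathbf{v}(\mathbf{x}_{t+1})\|>\|\mathbf{v}(\mathbf{x}_t)\|$, and $\beta_{t+2}=\beta_{t+1}$ otherwise; (3) set $\eta_{t+2}=1/\sqrt{\beta_{t+2}+\sum_{j=0}^t\|\mathbf{v}(\mathbf{x}_j)\|^2}$. *)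

theory Defs
  imports "HOL-Analysis.Analysis" "HOL-Library.Landau_Symbols"
begin

text \<open>
  The players are the elements of the finite type \<open>'p\<close>. A joint action in
  \<open>\<Prod>i. \<real>^(n i)\<close> is its concatenated coordinate vector in \<open>real ^ 'k\<close>; the map
  \<open>own :: 'k \<Rightarrow> 'p\<close> says which player controls a coordinate, so that player \<open>i\<close> has the
  block of coordinates \<open>own -` {i}\<close> and \<open>n i = card (own -` {i})\<close>. The dimensions of
  different players are thus independent of each other, and the norm and inner product of
  \<open>real ^ 'k\<close> are the Euclidean ones on the product.
\<close>

text \<open>\<open>deviate own i y x\<close> is the joint action \<open>(y_i, x_{-i})\<close>.\<close>

definition deviate :: "('k \<Rightarrow> 'p) \<Rightarrow> 'p \<Rightarrow> real ^ 'k \<Rightarrow> real ^ 'k \<Rightarrow> real ^ ('k :: finite)" where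
  "deviate own i y x = (\<chi> k. if own k = i then y $ k else x $ k)"

text \<open>
  The partial gradient in \<open>x_i\<close> is the gradient of \<open>y_i \<mapsto> u_i (y_i, x_{-i})\<close> at \<open>y_i = x_i\<close>.
  This map is written as a function of a full vector \<open>y\<close> that ignores the coordinates of \<open>y\<close>
  outside block \<open>i\<close>; its gradient is therefore the partial gradient extended by zero outside
  block \<open>i\<close>, and it exists iff the map is (Frechet) differentiable in \<open>y_i\<close>.
\<close>

definition has_partial_gradient ::
    "('k \<Rightarrow> 'p) \<Rightarrow> ('p \<Rightarrow> real ^ 'k \<Rightarrow> real) \<Rightarrow> 'p \<Rightarrow> real ^ 'k \<Rightarrow> real ^ ('k :: finite) \<Rightarrow> bool" where
  "has_partial_gradient own u i x g \<longleftrightarrow> (GDERIV (\<lambda>y. u i (deviate own i y x)) x :> g)"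

definition partial_gradient ::
    "('k \<Rightarrow> 'p) \<Rightarrow> ('p \<Rightarrow> real ^ 'k \<Rightarrow> real) \<Rightarrow> 'p \<Rightarrow> real ^ 'k \<Rightarrow> real ^ ('k :: finite)" where
  "partial_gradient own u i x = (THE g. has_partial_gradient own u i x g)"

text \<open>The concatenation \<open>v = (v_1, \<dots>, v_N)\<close> of the blocks of the partial gradients.\<close>

definition game_gradient ::
    "('k \<Rightarrow> 'p) \<Rightarrow> ('p \<Rightarrow> real ^ 'k \<Rightarrow> real) \<Rightarrow> real ^ 'k \<Rightarrow> real ^ ('k :: finite)" where
  "game_gradient own u x = (\<chi> k. partial_gradient own u (own k) x $ k)"

text \<open>
  The second and third conjuncts state that \<open>u i\<close> is continuously differentiable in \<open>x_i\<close>
  for every fixed \<open>x_{-i}\<close>.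
\<close>

definition continuous_game ::
    "('k :: finite \<Rightarrow> 'p :: finite) \<Rightarrow> ('p \<Rightarrow> real ^ 'k \<Rightarrow> real) \<Rightarrow> bool" where
  "continuous_game own u \<longleftrightarrow>
     (\<forall>i. continuous_on UNIV (u i) \<and>
          (\<forall>x. \<exists>g. has_partial_gradient own u i x g) \<and>
          (\<forall>x. continuous_on UNIV (\<lambda>y. partial_gradient own u i (deviate own i y x))) \<and>
          (\<exists>L. L-lipschitz_on UNIV (partial_gradient own u i)))"

definition nash_equilibria ::
    "('k \<Rightarrow> 'p) \<Rightarrow> ('p \<Rightarrow> real ^ 'k \<Rightarrow> real) \<Rightarrow> (real ^ ('k :: finite)) set" where
  "nash_equilibria own u = {x. \<forall>i y. u i x \<ge> u i (deviate own i y x)}"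

definition cocoercive_game ::
    "real \<Rightarrow> ('k :: finite \<Rightarrow> 'p) \<Rightarrow> ('p \<Rightarrow> real ^ 'k \<Rightarrow> real) \<Rightarrow> bool" where
  "cocoercive_game lam own u \<longleftrightarrow>
     (\<forall>x x'. (x' - x) \<bullet> (game_gradient own u x' - game_gradient own u x)
             \<le> - lam * (norm (game_gradient own u x' - game_gradient own u x))\<^sup>2)"

text \<open>
  The run of adaptive online gradient descent on the gradient field \<open>v\<close>, as a relation between
  the iterates \<open>x\<close> and the parameter sequences \<open>\<beta>\<close>, \<open>\<eta>\<close>, which start at index \<open>1\<close> (their values
  at \<open>0\<close> are irrelevant). The players' simultaneous updates are one update of the joint vector.
\<close>

definition adaptive_ogd ::
    "('a :: real_normed_vector \<Rightarrow> 'a) \<Rightarrow> real \<Rightarrow> (nat \<Rightarrow> 'a) \<Rightarrow> (nat \<Rightarrow> real) \<Rightarrow> (nat \<Rightarrow> real) \<Rightarrow> bool"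
  where
  "adaptive_ogd v r x \<beta> \<eta> \<longleftrightarrow>
     \<eta> 1 = 1 / \<beta> 1 \<and>
     (\<forall>t. x (t + 1) = x t + \<eta> (t + 1) *\<^sub>R v (x t) \<and>
          \<beta> (t + 2) = (if norm (v (x (t + 1))) > norm (v (x t)) then r * \<beta> (t + 1) else \<beta> (t + 1)) \<and>
          \<eta> (t + 2) = 1 / sqrt (\<beta> (t + 2) + (\<Sum>j\<le>t. (norm (v (x j)))\<^sup>2)))"

end

theory Submission
  imports Defs
begin

text \<open>
  Cocoercivity gives, for a step of size \<open>\<eta>\<close>,
  \<open>\<parallel>v (x (t + 1))\<parallel>\<^sup>2 \<le> \<parallel>v (x t)\<parallel>\<^sup>2 + (1 - 2 * lam / \<eta>) * \<parallel>v (x (t + 1)) - v (x t)\<parallel>\<^sup>2\<close>, so the gradient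
  norm cannot increase once \<open>\<eta> \<le> 2 * lam\<close>. Every increase multiplies \<open>\<beta>\<close> by \<open>r > 1\<close>, so either
  \<open>\<eta>\<close> drops to \<open>2 * lam\<close> or \<open>\<beta>\<close> stays bounded; in both cases the norm is eventually nonincreasing
  and \<open>\<beta>\<close> is bounded by some \<open>B\<close>. Let \<open>S t = (\<Sum>j<t. \<parallel>v (x j)\<parallel>\<^sup>2)\<close> and let \<open>z\<close> be a zero of \<open>v\<close>. Once
  \<open>\<eta> \<le> lam\<close>, the function \<open>lam * sqrt (B + S t) + \<parallel>x t - z\<parallel>\<^sup>2\<close> is nonincreasing, so \<open>S\<close> is bounded (if
  \<open>\<eta>\<close> never drops to \<open>lam\<close>, then \<open>S\<close> is bounded by the formula for \<open>\<eta>\<close>). An eventually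
  nonincreasing summable sequence is \<open>o(1 / T)\<close>.
\<close>

section \<open>Two facts of real analysis\<close>

text \<open>Each of the at least \<open>n / 2\<close> terms with index in
  \<open>{n div 2..<n}\<close> is at least \<open>f n\<close>, so \<open>n * f n\<close> is at most
  twice a Cauchy block of the series.\<close>

lemma olivier:
  fixes f :: "nat \<Rightarrow> real"
  assumes f: "summable f" and nonneg: "\<And>n. 0 \<le> f n"
    and decreasing: "\<And>n. n \<ge> N \<Longrightarrow> f (Suc n) \<le> f n"
  shows "(\<lambda>n. real n * f n) \<longlonglongrightarrow> 0"
proof (rule LIMSEQ_I)
  fix e :: real
  assume "e > 0"
  then obtain M where M: "\<And>m n. m \<ge> M \<Longrightarrow> norm (sum f {m..<n}) < e / 2"
    using f unfolding summable_Cauchy by (meson half_gt_zero)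
  have "norm (real n * f n - 0) < e" if n: "n \<ge> 2 * max M N" for n
  proof -
    have "f n \<le> f j" if "j \<in> {n div 2..<n}" for j
    proof (rule lift_Suc_antimono_le_ivl[of "{N..}" f])
      show "f (Suc m) \<le> f m" if "m \<in> {N..}" for m
        using decreasing that by simp
    qed (use that n in auto)
    then have "real (n - n div 2) * f n \<le> sum f {n div 2..<n}"
      using sum_bounded_below[of "{n div 2..<n}" "f n" f] by simp
    also have "\<dots> \<le> norm (sum f {n div 2..<n})"
      by simp
    also have "\<dots> < e / 2"
      using n by (intro M) linarith
    finally have "real (n - n div 2) * f n < e / 2" .
    moreover have "real n * f n \<le> (2 * real (n - n div 2)) * f n"
      by (intro mult_right_mono nonneg) linarith
    ultimately have "real n * f n < e"
      by linarith
    then show ?thesis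
      using nonneg[of n] by simp
  qed
  then show "\<exists>no. \<forall>n\<ge>no. norm (real n * f n - 0) < e"
    by blast
qed

text \<open>The tangent at \<open>p\<close> has half this slope; the weaker bound suffices, because
  with \<open>a\<close> a squared gradient norm it matches the decrease in
  \<open>dist_zero_step\<close>.\<close>

lemma sqrt_add_le_tangent:
  assumes "p > 0" "a \<ge> 0"
  shows "sqrt (p + a) \<le> sqrt p + a / sqrt p"
proof (rule real_le_lsqrt)
  have "(sqrt p + a / sqrt p)\<^sup>2 = p + 2 * a + (a / sqrt p)\<^sup>2"
    using assms by (simp add: power2_sum)
  then show "p + a \<le> (sqrt p + a / sqrt p)\<^sup>2"
    using assms by simp
qed (use assms in auto)

section \<open>Nash equilibria and the gradient field\<close>

lemma game_gradient_nash_eq_0: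
  assumes game: "continuous_game own u" and z: "z \<in> nash_equilibria own u"
  shows "game_gradient own u z = 0"
proof -
  have zero: "g = 0" if "has_partial_gradient own u i z g" for i g
  proof -
    have "deviate own i z z = z"
      by (simp add: deviate_def vec_eq_iff)
    then have "\<forall>y\<in>UNIV. u i (deviate own i y z) \<le> u i (deviate own i z z)"
      using z by (simp add: nash_equilibria_def)
    moreover have "((\<lambda>y. u i (deviate own i y z)) has_derivative (\<lambda>h. h \<bullet> g)) (at z)"
      using that by (simp add: has_partial_gradient_def gderiv_def)
    ultimately have "(\<lambda>h. h \<bullet> g) = (\<lambda>h. 0)"
      by (intro differential_zero_maxmin[of z UNIV]) auto
    then show ?thesis
      by (metis inner_eq_zero_iff)
  qed
  \<comment> \<open>The \<open>THE\<close> needs existence and uniqueness: the game provides some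
    partial gradient at \<open>z\<close>, and by Fermat's rule each one is 0.\<close>
  have "partial_gradient own u i z = 0" for i
    unfolding partial_gradient_def
  proof (rule the1_equality)
    obtain g where "has_partial_gradient own u i z g"
      using game unfolding continuous_game_def by blast
    then show "has_partial_gradient own u i z 0"
      using zero by blast
    then show "\<exists>!g. has_partial_gradient own u i z g"
      using zero by blast
  qed
  then show ?thesis
    by (simp add: game_gradient_def vec_eq_iff)
qed

section \<open>Step sizes of the algorithm\<close>

locale cocoercive_ogd =
  fixes v :: "'a :: real_inner \<Rightarrow> 'a" and lam r :: real
    and x :: "nat \<Rightarrow> 'a" and \<beta> \<eta> :: "nat \<Rightarrow> real" and z :: 'a
  assumes lam_pos: "lam > 0" and r_gt_1: "r > 1" and \<beta>_1_pos: "\<beta> 1 > 0"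
    and cocoercive: "(y' - y) \<bullet> (v y' - v y) \<le> - lam * (norm (v y' - v y))\<^sup>2"
    and zero: "v z = 0"
    and ogd: "adaptive_ogd v r x \<beta> \<eta>"
begin

text \<open>Index \<open>t\<close> is excluded, so that for \<open>t \<ge> 1\<close> this is the sum
  under the root in \<open>\<eta> (Suc t)\<close>.\<close>

definition S :: "nat \<Rightarrow> real" where
  "S t = (\<Sum>j<t. (norm (v (x j)))\<^sup>2)"

lemma S_Suc: "S (Suc t) = S t + (norm (v (x t)))\<^sup>2"
  by (simp add: S_def)

lemma S_nonneg: "S t \<ge> 0"
  by (simp add: S_def sum_nonneg)

lemma x_Suc: "x (Suc t) = x t + \<eta> (Suc t) *\<^sub>R v (x t)"
  using ogd by (simp add: adaptive_ogd_def)

lemma \<beta>_Suc: "\<beta> (Suc (Suc t)) =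
    (if norm (v (x (Suc t))) > norm (v (x t)) then r * \<beta> (Suc t) else \<beta> (Suc t))"
  using ogd by (simp add: adaptive_ogd_def numeral_2_eq_2)

text \<open>The formula fails for \<open>t = 0\<close>, where \<open>\<eta> 1\<close> is \<open>1 / \<beta> 1\<close> without a square root.\<close>

lemma \<eta>_Suc:
  assumes "t \<ge> 1"
  shows "\<eta> (Suc t) = 1 / sqrt (\<beta> (Suc t) + S t)"
proof -
  obtain s where "t = Suc s"
    using assms by (cases t) auto
  then show ?thesis
    using ogd by (simp add: adaptive_ogd_def numeral_2_eq_2 S_def lessThan_Suc_atMost)
qed

lemma \<beta>_ge: "\<beta> (Suc t) \<ge> \<beta> 1"
proof (induction t)
  case (Suc t)
  then have "1 * \<beta> (Suc t) \<le> r * \<beta> (Suc t)"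
    using r_gt_1 \<beta>_1_pos by (intro mult_right_mono) auto
  with Suc show ?case
    by (simp add: \<beta>_Suc)
qed simp

lemma \<beta>_pos: "\<beta> (Suc t) > 0"
  using \<beta>_ge \<beta>_1_pos by (rule less_le_trans[rotated])

lemma incseq_\<beta>: "incseq (\<lambda>t. \<beta> (Suc t))"
proof (rule incseq_SucI)
  fix t
  have "1 * \<beta> (Suc t) \<le> r * \<beta> (Suc t)"
    using r_gt_1 \<beta>_pos[of t] by (intro mult_right_mono) auto
  then show "\<beta> (Suc t) \<le> \<beta> (Suc (Suc t))"
    by (simp add: \<beta>_Suc)
qed

lemma \<beta>_plus_S_pos: "\<beta> (Suc t) + S t > 0"
  using \<beta>_pos S_nonneg by (rule add_pos_nonneg)

lemma \<eta>_pos: "\<eta> (Suc t) > 0"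
proof (cases "t \<ge> 1")
  case True
  then show ?thesis
    by (simp add: \<eta>_Suc \<beta>_plus_S_pos)
next
  case False
  then have "\<eta> (Suc t) = 1 / \<beta> 1"
    using ogd by (cases t) (auto simp: adaptive_ogd_def)
  then show ?thesis
    using \<beta>_1_pos by simp
qed

text \<open>Both \<open>\<beta>\<close> and \<open>S\<close> grow. The step size
  \<open>\<eta> 1\<close> is left out: for \<open>\<beta> 1 > 1\<close> it can be smaller than
  \<open>\<eta> 2\<close>.\<close>

lemma \<eta>_antimono:
  assumes "1 \<le> s" "s \<le> t"
  shows "\<eta> (Suc t) \<le> \<eta> (Suc s)"
proof -
  have "S s \<le> S t"
    unfolding S_def using assms by (intro sum_mono2) auto
  then have "\<beta> (Suc s) + S s \<le> \<beta> (Suc t) + S t"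
    using incseqD[OF incseq_\<beta> assms(2)] by linarith
  then show ?thesis
    using assms \<beta>_plus_S_pos[of s] by (simp add: \<eta>_Suc frac_le)
qed

lemma \<beta>_plus_S_le_if_\<eta>_gt:
  assumes "t \<ge> 1" "c > 0" "\<eta> (Suc t) > c"
  shows "\<beta> (Suc t) + S t \<le> (1 / c)\<^sup>2"
proof -
  have "sqrt (\<beta> (Suc t) + S t) \<le> 1 / c"
    using assms \<beta>_plus_S_pos[of t] by (simp add: \<eta>_Suc field_simps)
  then show ?thesis
    by (rule sqrt_le_D)
qed

section \<open>Eventual monotonicity of the gradient norm\<close>

lemma norm_decreases_if_\<eta>_le:
  assumes "\<eta> (Suc t) \<le> 2 * lam"
  shows "norm (v (x (Suc t))) \<le> norm (v (x t))"
proof -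
  define d where "d = v (x (Suc t)) - v (x t)"
  have "\<eta> (Suc t) * (v (x t) \<bullet> d) \<le> - lam * (norm d)\<^sup>2"
    using cocoercive[of "x (Suc t)" "x t"] by (simp add: x_Suc d_def)
  also have "\<dots> \<le> - (\<eta> (Suc t) / 2) * (norm d)\<^sup>2"
    using assms by (intro mult_right_mono) auto
  finally have "\<eta> (Suc t) * (2 * (v (x t) \<bullet> d) + (norm d)\<^sup>2) \<le> 0"
    by (simp add: algebra_simps)
  then have "2 * (v (x t) \<bullet> d) + (norm d)\<^sup>2 \<le> 0"
    using \<eta>_pos[of t] by (simp add: mult_le_0_iff)
  moreover have "(norm (v (x (Suc t))))\<^sup>2 = (norm (v (x t)))\<^sup>2 + (2 * (v (x t) \<bullet> d) + (norm d)\<^sup>2)"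
    by (simp add: d_def power2_norm_eq_inner algebra_simps inner_commute)
  ultimately have "(norm (v (x (Suc t))))\<^sup>2 \<le> (norm (v (x t)))\<^sup>2"
    by linarith
  then show ?thesis
    by (rule power2_le_imp_le) simp
qed

lemma eventually_norm_decreases:
  obtains T where "\<And>t. t \<ge> T \<Longrightarrow> norm (v (x (Suc t))) \<le> norm (v (x t))"
proof (cases "\<exists>T\<ge>1. \<eta> (Suc T) \<le> 2 * lam")
  case True
  then obtain T where "T \<ge> 1" "\<eta> (Suc T) \<le> 2 * lam"
    by blast
  then have "norm (v (x (Suc t))) \<le> norm (v (x t))" if "t \<ge> T" for t
    using that \<eta>_antimono[of T t] by (intro norm_decreases_if_\<eta>_le) auto
  then show ?thesis
    by (rule that)
next
  case False
  have bound: "\<beta> (Suc t) \<le> (1 / (2 * lam))\<^sup>2" for t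
  proof -
    \<comment> \<open>The case assumption concerns \<open>\<eta> (Suc T)\<close> with
      \<open>T \<ge> 1\<close> only; moving one index up covers \<open>t = 0\<close> too.\<close>
    have "\<beta> (Suc t) \<le> \<beta> (Suc (Suc t))"
      using incseq_\<beta> by (simp add: incseq_Suc_iff)
    also have "\<dots> \<le> \<beta> (Suc (Suc t)) + S (Suc t)"
      using S_nonneg by simp
    also have "\<dots> \<le> (1 / (2 * lam))\<^sup>2"
      using False lam_pos by (intro \<beta>_plus_S_le_if_\<eta>_gt) (auto simp: not_le)
    finally show ?thesis .
  qed
  \<comment> \<open>Increments of a convergent sequence tend to 0, whereas each increase of the norm
    adds at least \<open>(r - 1) * \<beta> 1\<close> to \<open>\<beta>\<close>.\<close>
  obtain L where L: "(\<lambda>t. \<beta> (Suc t)) \<longlonglongrightarrow> L"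
    using incseq_convergent[OF incseq_\<beta>] bound by blast
  have "(\<lambda>t. \<beta> (Suc (Suc t)) - \<beta> (Suc t)) \<longlonglongrightarrow> L - L"
    using LIMSEQ_Suc[OF L] L by (rule tendsto_diff)
  moreover have "(r - 1) * \<beta> 1 > 0"
    using r_gt_1 \<beta>_1_pos by simp
  ultimately have "eventually (\<lambda>t. \<beta> (Suc (Suc t)) - \<beta> (Suc t) < (r - 1) * \<beta> 1) sequentially"
    by (intro order_tendstoD(2)) auto
  then obtain T where T: "\<And>t. t \<ge> T \<Longrightarrow> \<beta> (Suc (Suc t)) - \<beta> (Suc t) < (r - 1) * \<beta> 1"
    by (auto simp: eventually_sequentially)
  have "norm (v (x (Suc t))) \<le> norm (v (x t))" if "t \<ge> T" for t
  proof (rule ccontr)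
    assume "\<not> ?thesis"
    then have "\<beta> (Suc (Suc t)) - \<beta> (Suc t) = (r - 1) * \<beta> (Suc t)"
      by (simp add: \<beta>_Suc algebra_simps)
    also have "\<dots> \<ge> (r - 1) * \<beta> 1"
      using r_gt_1 \<beta>_ge by (intro mult_left_mono) auto
    finally show False
      using T[OF that] by linarith
  qed
  then show ?thesis
    by (rule that)
qed

text \<open>Once the norm has stopped increasing, \<open>\<beta>\<close> is frozen.\<close>

lemma \<beta>_bounded:
  obtains B where "B > 0" "\<And>t. \<beta> (Suc t) \<le> B"
proof -
  obtain T where T: "\<And>t. t \<ge> T \<Longrightarrow> norm (v (x (Suc t))) \<le> norm (v (x t))"
    using eventually_norm_decreases by blast
  have const: "\<beta> (Suc t) = \<beta> (Suc T)" if "t \<ge> T" for t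
    using that
  proof (induction t rule: dec_induct)
    case (step t)
    then show ?case
      using T[of t] by (simp add: \<beta>_Suc)
  qed simp
  have "\<beta> (Suc t) \<le> \<beta> (Suc T)" for t
    using const[of t] incseqD[OF incseq_\<beta>, of t T] by (cases "t \<ge> T") auto
  then show ?thesis
    using \<beta>_pos by (intro that)
qed

section \<open>Summability of the squared gradient norms\<close>

text \<open>Cocoercivity against the zero \<open>z\<close> makes the cross term of the expanded
  square at most \<open>- 2 * lam * \<eta> * \<parallel>v\<parallel>\<^sup>2\<close>; the quadratic
  term consumes at most half of this when \<open>\<eta> \<le> lam\<close>.\<close>

lemma dist_zero_step:
  assumes "\<eta> (Suc t) \<le> lam"
  shows "(norm (x (Suc t) - z))\<^sup>2 + lam * (\<eta> (Suc t) * (norm (v (x t)))\<^sup>2) \<le> (norm (x t - z))\<^sup>2"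
proof -
  let ?h = "\<eta> (Suc t)" and ?a = "(norm (v (x t)))\<^sup>2"
  have "x (Suc t) - z = (x t - z) + ?h *\<^sub>R v (x t)"
    by (simp add: x_Suc)
  then have "(norm (x (Suc t) - z))\<^sup>2 =
      (norm (x t - z))\<^sup>2 + 2 * (?h * ((x t - z) \<bullet> v (x t))) + ?h * (?h * ?a)"
    by (simp add: power2_norm_eq_inner inner_commute algebra_simps)
  moreover have "?h * ((x t - z) \<bullet> v (x t)) \<le> ?h * (- lam * ?a)"
    using cocoercive[of "x t" z] \<eta>_pos[of t] by (intro mult_left_mono) (auto simp: zero)
  moreover have "?h * (?h * ?a) \<le> ?h * (lam * ?a)"
    using assms \<eta>_pos[of t] by (intro mult_left_mono mult_right_mono) auto
  ultimately show ?thesis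
    by (simp add: algebra_simps)
qed

lemma lyapunov_step:
  assumes "t \<ge> 1" "\<eta> (Suc t) \<le> lam" and B: "\<beta> (Suc t) \<le> B" "B > 0"
  shows "lam * sqrt (B + S (Suc t)) + (norm (x (Suc t) - z))\<^sup>2
      \<le> lam * sqrt (B + S t) + (norm (x t - z))\<^sup>2"
proof -
  let ?a = "(norm (v (x t)))\<^sup>2"
  have "sqrt (B + S (Suc t)) \<le> sqrt (B + S t) + ?a / sqrt (B + S t)"
    using sqrt_add_le_tangent[of "B + S t" ?a] B S_nonneg[of t] by (simp add: S_Suc add.assoc)
  \<comment> \<open>Having the constant \<open>B\<close> in place of \<open>\<beta>\<close> keeps
    changes of \<open>\<beta>\<close> out of the Lyapunov function and only enlarges the
    denominator.\<close>
  also have "?a / sqrt (B + S t) \<le> ?a / sqrt (\<beta> (Suc t) + S t)"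
    using B \<beta>_plus_S_pos[of t] by (intro divide_left_mono mult_pos_pos) auto
  also have "\<dots> = \<eta> (Suc t) * ?a"
    using assms(1) by (simp add: \<eta>_Suc)
  finally have "lam * sqrt (B + S (Suc t)) \<le> lam * (sqrt (B + S t) + \<eta> (Suc t) * ?a)"
    using lam_pos by (intro mult_left_mono) auto
  then show ?thesis
    using dist_zero_step[OF assms(2)] by (simp add: algebra_simps)
qed

lemma S_bounded:
  obtains C where "\<And>t. S t \<le> C"
proof (cases "\<exists>T\<ge>1. \<eta> (Suc T) \<le> lam")
  case False
  have "S t \<le> (1 / lam)\<^sup>2" for t
  proof -
    have "S t \<le> S (Suc t)"
      by (simp add: S_Suc)
    also have "\<dots> \<le> \<beta> (Suc (Suc t)) + S (Suc t)"
      using \<beta>_pos[of "Suc t"] by simp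
    also have "\<dots> \<le> (1 / lam)\<^sup>2"
      using False lam_pos by (intro \<beta>_plus_S_le_if_\<eta>_gt) (auto simp: not_le)
    finally show ?thesis .
  qed
  then show ?thesis
    by (rule that)
next
  case True
  then obtain T where T: "T \<ge> 1" "\<eta> (Suc T) \<le> lam"
    by blast
  obtain B where B: "B > 0" "\<And>t. \<beta> (Suc t) \<le> B"
    using \<beta>_bounded by blast
  define V where "V t = lam * sqrt (B + S t) + (norm (x t - z))\<^sup>2" for t
  have V: "V t \<le> V T" if "t \<ge> T" for t
    using that
  proof (induction t rule: dec_induct)
    case (step t)
    then have "V (Suc t) \<le> V t"
      unfolding V_def using T \<eta>_antimono[of T t] B by (intro lyapunov_step) auto
    with step.IH show ?case
      by simp
  qed simp
  have bound: "S t \<le> (V T / lam)\<^sup>2" if "t \<ge> T" for t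
  proof -
    have "lam * sqrt (B + S t) \<le> V t"
      by (simp add: V_def)
    then have "sqrt (B + S t) \<le> V T / lam"
      using V[OF that] lam_pos by (simp add: field_simps)
    then have "B + S t \<le> (V T / lam)\<^sup>2"
      by (rule sqrt_le_D)
    then show ?thesis
      using B by simp
  qed
  have "S t \<le> (V T / lam)\<^sup>2" for t
  proof -
    \<comment> \<open>Monotonicity of \<open>S\<close> extends the bound to the indices before
      \<open>T\<close>.\<close>
    have "S t \<le> S (max t T)"
      unfolding S_def by (intro sum_mono2) auto
    then show ?thesis
      using bound[of "max t T"] by simp
  qed
  then show ?thesis
    by (rule that)
qed

theorem norm_power2_smallo: "(\<lambda>T. (norm (v (x T)))\<^sup>2) \<in> o(\<lambda>T. 1 / real T)"
proof (rule smalloI_tendsto)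
  obtain C where "\<And>t. S t \<le> C"
    using S_bounded by blast
  then have "summable (\<lambda>t. (norm (v (x t)))\<^sup>2)"
    by (intro summableI_nonneg_bounded[where x = C]) (auto simp: S_def)
  moreover obtain T where "\<And>t. t \<ge> T \<Longrightarrow> norm (v (x (Suc t))) \<le> norm (v (x t))"
    using eventually_norm_decreases by blast
  ultimately have "(\<lambda>t. real t * (norm (v (x t)))\<^sup>2) \<longlonglongrightarrow> 0"
    by (intro olivier[where N = T] power_mono) auto
  then show "(\<lambda>T. (norm (v (x T)))\<^sup>2 / (1 / real T)) \<longlonglongrightarrow> 0"
    by (simp add: mult.commute)
  \<comment> \<open>At \<open>T = 0\<close> the comparison function is
    \<open>1 / 0 = 0\<close>.\<close>
  show "eventually (\<lambda>T. 1 / real T \<noteq> 0) sequentially"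
    using eventually_gt_at_top[of 0] by eventually_elim simp
qed

end

theorem theorem3p4:
  fixes own :: "'k :: finite \<Rightarrow> 'p :: finite"
    and u :: "'p \<Rightarrow> real ^ 'k \<Rightarrow> real"
    and x :: "nat \<Rightarrow> real ^ 'k"
    and \<beta> \<eta> :: "nat \<Rightarrow> real"
    and lam r :: real
  assumes "continuous_game own u"
    and "lam > 0"
    and "cocoercive_game lam own u"
    and "nash_equilibria own u \<noteq> {}"
    and "\<beta> 1 > 0"
    and "r > 1"
    and "adaptive_ogd (game_gradient own u) r x \<beta> \<eta>"
  shows "(\<lambda>T. (norm (game_gradient own u (x T)))\<^sup>2) \<in> o(\<lambda>T. 1 / real T)"
proof -
  obtain z where z: "z \<in> nash_equilibria own u"
    using assms(4) by blast
  interpret cocoercive_ogd "game_gradient own u" lam r x \<beta> \<eta> z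
    using assms game_gradient_nash_eq_0[OF assms(1) z]
    by unfold_locales (auto simp: cocoercive_game_def)
  show ?thesis
    by (rule norm_power2_smallo)
qed

end
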